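(* Let $(X,d)$ be a separable, directionally limited metric space endowed with an asymptotically $(\alpha,\gamma)$-bounded measure $\nu$, for some constants $\alpha\in(0,1]$ and $\gamma\ge1$, and let $\mu$ be a positive Borel measure on $X$. Let $$A_0=\Big\{x\in X:\liminf_{r\to0^+}\frac{\mu(B_r(x))}{\nu(B_r(x))}=0\Big\},\qquad A_+=\Big\{x\in X:0<\liminf_{r\to0^+}\frac{\mu(B_r(x))}{\nu(B_r(x))}\le+\infty\Big\}.$$ Then the following hold. (i) For all $x\in A_+$, either $\mu(B_r(x))=+\infty$ for all $r>0$, or $$\liminf_{r\to0^+}\frac{\mu(B_r(x))}{\mu(B_{\alpha r}(x))}\le\gamma.$$ (ii) $\mu(A_0)=0$. In particular, for every fixed $\epsilon_0>0$ and for $\mu$-almost every $x\in X$, there exists a decreasing infinitesimal sequence $(r_n)_n$ of radii (depending on $\epsilon_0$ and $x$) such that $$\mu(B_{r_n}(x))\le(\gamma+\epsilon_0)\,\mu(B_{\alpha r_n}(x))\qquad\forall n\in\mathbb N.$$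
   Context: Balls: $B_r(x)=\{y\in X: d(x,y)\le r\}$ is the closed ball and $U_r(x)=\{y\in X: d(x,y)<r\}$ the open ball, $r>0$. If a set is not Borel, its $\mu$-measure is understood as the outer measure $\inf\{\mu(B):B\text{ Borel containing the set}\}$. Directionally limited: let $\xi>0$, $0<\eta\le\frac13$, $\zeta\in\{1,2,\dots\}$ and $A\subset X$. The distance $d$ is directionally $(\xi,\eta,\zeta)$-limited at $A$ if, for every $a\in A$ and every $B\subset A\cap(U_\xi(a)\setminus\{a\})$ with the property that for all $b,c\in B$ with $b\ne c$ and $d(a,b)\ge d(a,c)$ and all $x\in X$ with $d(a,x)=d(a,c)$ and $d(a,x)+d(x,b)=d(a,b)$ one has $\frac{d(x,c)}{d(a,c)}\ge\eta$, it holds that $\operatorname{card}B\le\zeta$. $(X,d)$ is directionally limited if $d$ is directionally $(\xi,\eta,\zeta)$-limited at $X$ for some such $(\xi,\eta,\zeta)$. Asymptotically $(\alpha,\gamma)$-bounded measure: a positive Borel measure $\nu$ on $X$ that is finite on bounded sets, strictly positive on every ball of positive radius, and such that $\limsup_{r\to0^+}\frac{\nu(B_r(x))}{\nu(B_{\alpha r}(x))}\le\gamma$ for all $x\in X$. *)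

theory Defs
  imports "HOL-Analysis.Analysis"
begin

(* finite B is required explicitly because card of an infinite set is 0. *)
definition directionally_limited_at ::
    "real \<Rightarrow> real \<Rightarrow> nat \<Rightarrow> 'a::metric_space set \<Rightarrow> bool" where
  "directionally_limited_at \<xi> \<eta> \<zeta> A \<longleftrightarrow>
     (\<forall>a\<in>A. \<forall>B. B \<subseteq> A \<inter> (ball a \<xi> - {a}) \<longrightarrow>
        (\<forall>b\<in>B. \<forall>c\<in>B. b \<noteq> c \<longrightarrow> dist a b \<ge> dist a c \<longrightarrow>
           (\<forall>x. dist a x = dist a c \<longrightarrow> dist a x + dist x b = dist a b \<longrightarrow>
              dist x c / dist a c \<ge> \<eta>)) \<longrightarrow>
        finite B \<and> card B \<le> \<zeta>)"

definition directionally_limited :: "'a::metric_space itself \<Rightarrow> bool" where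
  "directionally_limited _ \<longleftrightarrow>
     (\<exists>\<xi> \<eta> \<zeta>. 0 < \<xi> \<and> 0 < \<eta> \<and> \<eta> \<le> 1/3 \<and> 1 \<le> \<zeta> \<and>
        directionally_limited_at \<xi> \<eta> \<zeta> (UNIV :: 'a set))"

definition asymptotically_bounded ::
    "real \<Rightarrow> real \<Rightarrow> 'a::metric_space measure \<Rightarrow> bool" where
  "asymptotically_bounded \<alpha> \<gamma> \<nu> \<longleftrightarrow>
     sets \<nu> = sets borel \<and>
     (\<forall>B\<in>sets borel. bounded B \<longrightarrow> emeasure \<nu> B < \<infinity>) \<and>
     (\<forall>x. \<forall>r>0. 0 < emeasure \<nu> (ball x r) \<and> 0 < emeasure \<nu> (cball x r)) \<and>
     (\<forall>x. Limsup (at_right 0)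
            (\<lambda>r. emeasure \<nu> (cball x r) / emeasure \<nu> (cball x (\<alpha> * r))) \<le> ennreal \<gamma>)"

definition lower_density ::
    "'a::metric_space measure \<Rightarrow> 'a measure \<Rightarrow> 'a \<Rightarrow> ennreal" where
  "lower_density \<mu> \<nu> x =
     Liminf (at_right 0) (\<lambda>r. emeasure \<mu> (cball x r) / emeasure \<nu> (cball x r))"

end

theory Submission
  imports Defs
begin

text \<open>
  Part (i): if \<open>\<mu>(B\<^sub>r) / \<mu>(B\<^bsub>\<alpha>r\<^esub>) > q > p > \<nu>(B\<^sub>r) / \<nu>(B\<^bsub>\<alpha>r\<^esub>)\<close> for all small \<open>r\<close>, then passing from
  \<open>r\<close> to \<open>\<alpha>r\<close> multiplies the density \<open>\<mu>(B\<^sub>r) / \<nu>(B\<^sub>r)\<close> by at most \<open>p/q < 1\<close>, so its lower limit vanishes.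
  Part (ii): a Besicovitch covering argument. A greedy choice of balls, from large to small radii,
  covers the set of centres, and in a directionally limited space every point lies in at most
  \<open>\<zeta> + 1\<close> of the chosen balls. If these satisfy \<open>\<mu>(B) \<le> \<epsilon> \<nu>(B)\<close>, summing gives
  \<open>\<mu>(A) \<le> \<epsilon> (\<zeta> + 1) \<nu>(V)\<close> for a fixed bounded \<open>V\<close>. Bounded overlap replaces the usual
  splitting into disjoint subfamilies.
\<close>

section \<open>Greedy selection of balls with comparable radii\<close>

text \<open>What a greedy selection leaves behind, with the order of selection forgotten: of two
  centres, the one chosen first has a ball that misses the other centre, and its radius is the
  larger up to the factor \<open>\<tau>\<close>.\<close>

definition controlled :: "real \<Rightarrow> ('a::metric_space \<Rightarrow> real) \<Rightarrow> 'a set \<Rightarrow> bool" where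
  "controlled \<tau> s S \<longleftrightarrow> (\<forall>b\<in>S. \<forall>c\<in>S. b \<noteq> c \<longrightarrow>
     (s b < dist b c \<and> s c < \<tau> * s b) \<or> (s c < dist b c \<and> s b < \<tau> * s c))"

text \<open>\<open>P\<close> occurs negatively in its own specification, so no monotone fixed point
  applies. Well-founded recursion does, since \<open>P a\<close> consults only
  \<open>W\<close>-predecessors of \<open>a\<close>.\<close>

lemma wf_greedy_selection:
  assumes "wf W"
  obtains P where "\<And>a. P a \<longleftrightarrow> (\<forall>b. (b, a) \<in> W \<longrightarrow> P b \<longrightarrow> Q a b)"
proof
  let ?F = "\<lambda>f a. \<forall>b. (b, a) \<in> W \<longrightarrow> f b \<longrightarrow> Q a b"
  show "wfrec W ?F a \<longleftrightarrow> (\<forall>b. (b, a) \<in> W \<longrightarrow> wfrec W ?F b \<longrightarrow> Q a b)" for a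
    by (subst wfrec[OF assms]) (auto simp: cut_def)
qed

lemma exists_controlled_cover:
  fixes A :: "'a::metric_space set"
  assumes \<tau>: "1 < \<tau>" and s: "\<And>a. a \<in> A \<Longrightarrow> 0 < s a" "\<And>a. a \<in> A \<Longrightarrow> s a \<le> R"
  obtains S where "S \<subseteq> A" "controlled \<tau> s S" "A \<subseteq> (\<Union>c\<in>S. cball c (s c))"
proof -
  \<comment> \<open>Radii with the same \<open>k\<close> differ by a factor less than \<open>\<tau>\<close>, so a greedy choice along a
    well-order refining \<open>k\<close> avoids the need for a largest radius.\<close>
  define k where "k a = (LEAST k. R < \<tau> ^ Suc k * s a)" for a
  have k_upper: "R < \<tau> ^ Suc (k a) * s a" if "a \<in> A" for a
  proof -
    obtain n where n: "R / s a < \<tau> ^ n"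
      using real_arch_pow[OF \<tau>] by blast
    have "\<tau> ^ n \<le> \<tau> ^ Suc n"
      using \<tau> by (intro power_increasing) auto
    with n have "R / s a < \<tau> ^ Suc n"
      by linarith
    then have "R < \<tau> ^ Suc n * s a"
      using s(1)[OF that] by (simp add: pos_divide_less_eq)
    then show ?thesis
      unfolding k_def by (rule LeastI)
  qed
  have k_lower: "\<tau> ^ k a * s a \<le> R" if "a \<in> A" for a
  proof (cases "k a")
    case 0
    then show ?thesis using s(2)[OF that] by simp
  next
    case (Suc j)
    then have "j < (LEAST k. R < \<tau> ^ Suc k * s a)"
      by (simp add: k_def)
    then show ?thesis
      using not_less_Least Suc by (metis not_less)
  qed
  \<comment> \<open>By definition, \<open>k\<close> marks the band R/\<tau>^(k+1) < s \<le>
    R/\<tau>^k. A centre in a band of larger or equal index can exceed an earlier radius only by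
    less than the factor \<tau>.\<close>
  have ratio: "s a < \<tau> * s b" if "a \<in> A" "b \<in> A" "k b \<le> k a" for a b
  proof -
    have "\<tau> ^ k a * s a < \<tau> ^ Suc (k b) * s b"
      using k_lower[OF that(1)] k_upper[OF that(2)] by linarith
    also have "\<dots> \<le> \<tau> ^ Suc (k a) * s b"
      using \<tau> that s(1)[OF that(2)] by (intro mult_right_mono power_increasing) auto
    finally have "\<tau> ^ k a * s a < \<tau> ^ k a * (\<tau> * s b)"
      by (simp add: ac_simps)
    then show ?thesis
      using \<tau> by simp
  qed
  obtain w :: "'a rel" where w: "Well_order w" "Field w = UNIV"
    using well_ordering by (elim exE conjE)
  \<comment> \<open>Bands come first and the arbitrary well-order \<open>w\<close> breaks ties
    within a band. Restricting to \<open>A\<close> makes every rejecting centre a member of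
    \<open>A\<close>.\<close>
  define W where "W = inv_image (less_than <*lex*> (w - Id)) (\<lambda>a. (k a, a)) \<inter> A \<times> A"
  have "wf (w - Id)"
    using w(1) by (simp add: well_order_on_def)
  then have "wf W"
    unfolding W_def by (intro wf_Int1 wf_inv_image wf_lex_prod wf_less_than)
  then obtain P where P: "\<And>a. P a \<longleftrightarrow> (\<forall>b. (b, a) \<in> W \<longrightarrow> P b \<longrightarrow> s b < dist b a)"
    by (rule wf_greedy_selection[where Q = "\<lambda>a b. s b < dist b a"]) blast
  have total: "(b, c) \<in> W \<or> (c, b) \<in> W" if "b \<in> A" "c \<in> A" "b \<noteq> c" for b c
  proof -
    have "(b, c) \<in> w \<or> (c, b) \<in> w"
      using w that(3) by (auto simp: well_order_on_def linear_order_on_def total_on_def)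
    then show ?thesis
      using that by (auto simp: W_def)
  qed
  have W_k: "k b \<le> k a" if "(b, a) \<in> W" for a b
    using that by (auto simp: W_def)
  show ?thesis
  proof
    show "{a\<in>A. P a} \<subseteq> A" by blast
    show "controlled \<tau> s {a\<in>A. P a}"
      unfolding controlled_def
    proof (intro ballI impI)
      fix b c
      assume "b \<in> {a\<in>A. P a}" "c \<in> {a\<in>A. P a}" "b \<noteq> c"
      then have *: "b \<in> A" "P b" "c \<in> A" "P c"
        by auto
      from total[OF *(1,3) \<open>b \<noteq> c\<close>]
      show "(s b < dist b c \<and> s c < \<tau> * s b) \<or> (s c < dist b c \<and> s b < \<tau> * s c)"
      proof
        assume W: "(b, c) \<in> W"
        then have "s b < dist b c"
          using P * by blast
        then show ?thesis
          using ratio[OF *(3,1) W_k[OF W]] by blast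
      next
        assume W: "(c, b) \<in> W"
        then have "s c < dist c b"
          using P * by blast
        then show ?thesis
          using ratio[OF *(1,3) W_k[OF W]] by (simp add: dist_commute)
      qed
    qed
    show "A \<subseteq> (\<Union>c\<in>{a\<in>A. P a}. cball c (s c))"
    proof
      fix a assume a: "a \<in> A"
      show "a \<in> (\<Union>c\<in>{a\<in>A. P a}. cball c (s c))"
      proof (cases "P a")
        case True
        then show ?thesis using a s(1)[OF a] by (auto intro!: bexI[of _ a])
      next
        \<comment> \<open>A rejected point lies in the selected ball that rejected it.\<close>
        case False
        then obtain b where "(b, a) \<in> W" "P b" "\<not> s b < dist b a"
          using P[of a] by blast
        then show ?thesis
          by (auto simp: W_def intro!: bexI[of _ b])
      qed
    qed
  qed
qed

section \<open>Bounded overlap in a directionally limited space\<close>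

lemma controlled_overlap:
  fixes s :: "'a::metric_space \<Rightarrow> real"
  assumes lim: "directionally_limited_at \<xi> \<eta> \<zeta> (UNIV :: 'a set)" and \<eta>: "\<eta> \<le> 1/2"
    and s: "\<And>c. c \<in> S \<Longrightarrow> 0 < s c" "\<And>c. c \<in> S \<Longrightarrow> s c < \<xi>"
    and ctrl: "controlled (9/8) s S"
  shows "finite {c\<in>S. x \<in> cball c (s c)} \<and> card {c\<in>S. x \<in> cball c (s c)} \<le> Suc \<zeta>"
proof -
  \<comment> \<open>Since \<open>\<tau> > 1\<close>, the directional condition at \<open>x\<close> can fail for centres much closer to \<open>x\<close> than
    their radius; but there is at most one such centre, as two of them would be too close together.\<close>
  define N where "N = {c\<in>S. dist x c < s c / 4}"
  define B where "B = {c\<in>S. s c / 4 \<le> dist x c \<and> dist x c \<le> s c}"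
  have near: "b = c" if "b \<in> N" "c \<in> N" for b c
  proof (rule ccontr)
    assume "b \<noteq> c"
    \<comment> \<open>Both distances are below a quarter of the radius. If \<open>b\<close> is the
      earlier centre, then dist b c < (1 + 9/8)/4 * s b < s b, against control.\<close>
    moreover have "dist b c \<le> dist x b + dist x c"
      by (metis dist_commute dist_triangle)
    ultimately show False
      using ctrl that s(1)[of b] s(1)[of c] unfolding controlled_def N_def by fastforce
  qed
  have N: "finite N \<and> card N \<le> 1"
  proof (cases "N = {}")
    case False
    then obtain c where "N = {c}" using near by blast
    then show ?thesis by simp
  qed simp
  have sep: "\<eta> \<le> dist y c / dist x c"
    if b: "b \<in> B" and c: "c \<in> B" and "b \<noteq> c"
      and y: "dist x y = dist x c" "dist x y + dist y b = dist x b" for b c y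
  proof -
    have pos: "0 < s b" "0 < s c" "0 < dist x c"
      using s(1) b c unfolding B_def by fastforce+
    have tri: "dist b c - dist x b + dist x c \<le> dist y c"
      using dist_triangle[of b c y] y by (simp add: dist_commute)
    \<comment> \<open>If \<open>c\<close> is outside the ball of \<open>b\<close>, then dist x b
      \<le> s b < dist b c. Otherwise dist b c - dist x b > s c - 9/8 * s c = -s c/8 \<ge> -dist x
      c/2, because \<open>c\<close> is not near. The constants 9/8 and 1/4 are matched to give this
      half.\<close>
    have "dist x c / 2 \<le> dist y c"
    proof -
      consider "s b < dist b c" | "s c < dist b c" "s b < 9/8 * s c"
        using ctrl b c \<open>b \<noteq> c\<close> unfolding controlled_def B_def by blast
      then show ?thesis
      proof cases
        case 1
        then have "dist x b < dist b c" using b unfolding B_def by simp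
        then show ?thesis using tri zero_le_dist[of x c] by linarith
      next
        case 2
        then show ?thesis using tri b c unfolding B_def by simp
      qed
    qed
    then have "1/2 \<le> dist y c / dist x c"
      using pos by (simp add: field_simps)
    then show ?thesis using \<eta> by linarith
  qed
  have "B \<subseteq> UNIV \<inter> (ball x \<xi> - {x})"
    using s unfolding B_def by fastforce
  then have B: "finite B \<and> card B \<le> \<zeta>"
    using lim sep unfolding directionally_limited_at_def by blast
  have eq: "{c\<in>S. x \<in> cball c (s c)} = N \<union> B"
    using s(1) unfolding N_def B_def by (force simp: dist_commute)
  show ?thesis
    using N B card_Un_le[of N B] unfolding eq by auto
qed

text \<open>Every ball contains a point of a countable dense set, and each such point meets only
  finitely many balls.\<close>

lemma countable_of_finite_overlap:
  fixes s :: "'a::metric_space \<Rightarrow> real"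
  assumes "separable_space (euclidean :: 'a topology)"
    and s: "\<And>c. c \<in> S \<Longrightarrow> 0 < s c"
    and fin: "\<And>x. finite {c\<in>S. x \<in> cball c (s c)}"
  shows "countable S"
proof -
  obtain D :: "'a set" where D: "countable D" "closure D = UNIV"
    using assms(1) unfolding separable_space_def by auto
  have "S \<subseteq> (\<Union>x\<in>D. {c\<in>S. x \<in> cball c (s c)})"
  proof
    fix c assume c: "c \<in> S"
    then obtain x where "x \<in> D" "dist x c < s c"
      using D(2) s by (metis UNIV_I closure_approachable)
    then show "c \<in> (\<Union>x\<in>D. {c\<in>S. x \<in> cball c (s c)})"
      using c by (auto simp: dist_commute intro!: bexI[of _ x])
  qed
  then show ?thesis
    by (rule countable_subset) (intro countable_UN D(1) countable_finite fin)
qed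

section \<open>Sums of measures as integrals of the overlap count\<close>

text \<open>Tonelli with a countable index set. In this form it also applies to \<mu>, which may
  fail to be sigma-finite.\<close>

lemma nn_integral_count_space_emeasure:
  assumes "countable S" "\<And>c. c \<in> S \<Longrightarrow> F c \<in> sets M"
  shows "(\<integral>\<^sup>+c. emeasure M (F c) \<partial>count_space S) =
    (\<integral>\<^sup>+x. emeasure (count_space S) {c\<in>S. x \<in> F c} \<partial>M)"
proof -
  have "(\<integral>\<^sup>+c. emeasure M (F c) \<partial>count_space S) =
    (\<integral>\<^sup>+c. (\<integral>\<^sup>+x. indicator (F c) x \<partial>M) \<partial>count_space S)"
    using assms(2) by (intro nn_integral_cong) simp
  also have "\<dots> = (\<integral>\<^sup>+x. (\<integral>\<^sup>+c. indicator (F c) x \<partial>count_space S) \<partial>M)"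
    using assms by (intro nn_integral_count_space_nn_integral[symmetric]) auto
  also have "\<dots> = (\<integral>\<^sup>+x. (\<integral>\<^sup>+c. indicator {c\<in>S. x \<in> F c} c \<partial>count_space S) \<partial>M)"
    by (intro nn_integral_cong) (auto simp: indicator_def)
  also have "\<dots> = (\<integral>\<^sup>+x. emeasure (count_space S) {c\<in>S. x \<in> F c} \<partial>M)"
    by (intro nn_integral_cong) (auto intro!: nn_integral_indicator)
  finally show ?thesis .
qed

text \<open>The overlap count is at least 1 on the union.\<close>

lemma emeasure_UN_le_nn_integral_count_space:
  assumes "countable S" "\<And>c. c \<in> S \<Longrightarrow> F c \<in> sets M"
  shows "emeasure M (\<Union>c\<in>S. F c) \<le> (\<integral>\<^sup>+c. emeasure M (F c) \<partial>count_space S)"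
proof -
  have U: "(\<Union>c\<in>S. F c) \<in> sets M"
    using assms by (intro sets.countable_UN') auto
  have *: "indicator (\<Union>c\<in>S. F c) x \<le> emeasure (count_space S) {c\<in>S. x \<in> F c}" for x
  proof (cases "x \<in> (\<Union>c\<in>S. F c)")
    case True
    then obtain c where c: "c \<in> S" "x \<in> F c" by blast
    have "1 = emeasure (count_space S) {c}"
      using c by simp
    also have "\<dots> \<le> emeasure (count_space S) {c\<in>S. x \<in> F c}"
      using c by (intro emeasure_mono) auto
    finally show ?thesis using True by simp
  qed simp
  have "emeasure M (\<Union>c\<in>S. F c) = (\<integral>\<^sup>+x. indicator (\<Union>c\<in>S. F c) x \<partial>M)"
    using U by simp
  also have "\<dots> \<le> (\<integral>\<^sup>+x. emeasure (count_space S) {c\<in>S. x \<in> F c} \<partial>M)"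
    by (intro nn_integral_mono *)
  also have "\<dots> = (\<integral>\<^sup>+c. emeasure M (F c) \<partial>count_space S)"
    using nn_integral_count_space_emeasure[OF assms] by simp
  finally show ?thesis .
qed

text \<open>The overlap count vanishes off \<open>V\<close> and is at most \<open>n\<close> on
  it.\<close>

lemma nn_integral_count_space_emeasure_overlap:
  assumes "countable S" "\<And>c. c \<in> S \<Longrightarrow> F c \<in> sets M"
    and V: "V \<in> sets M" "\<And>c. c \<in> S \<Longrightarrow> F c \<subseteq> V"
    and overlap: "\<And>x. finite {c\<in>S. x \<in> F c} \<and> card {c\<in>S. x \<in> F c} \<le> n"
  shows "(\<integral>\<^sup>+c. emeasure M (F c) \<partial>count_space S) \<le> of_nat n * emeasure M V"
proof -
  have *: "emeasure (count_space S) {c\<in>S. x \<in> F c} \<le> of_nat n * indicator V x" for x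
  proof (cases "{c\<in>S. x \<in> F c} = {}")
    case False
    then have "x \<in> V" using V(2) by blast
    have "emeasure (count_space S) {c\<in>S. x \<in> F c} = of_nat (card {c\<in>S. x \<in> F c})"
      using overlap[of x] by (intro emeasure_count_space_finite) auto
    then show ?thesis
      using overlap[of x] \<open>x \<in> V\<close> by simp
  next
    case True
    then show ?thesis by (simp only:) simp
  qed
  have "(\<integral>\<^sup>+c. emeasure M (F c) \<partial>count_space S) =
      (\<integral>\<^sup>+x. emeasure (count_space S) {c\<in>S. x \<in> F c} \<partial>M)"
    by (rule nn_integral_count_space_emeasure[OF assms(1,2)])
  also have "\<dots> \<le> (\<integral>\<^sup>+x. of_nat n * indicator V x \<partial>M)"
    by (intro nn_integral_mono *)
  also have "\<dots> = of_nat n * emeasure M V"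
    using V(1) by (simp add: nn_integral_cmult_indicator)
  finally show ?thesis .
qed

section \<open>Quotients, lower limits and sequences of radii\<close>

lemma ennreal_le_mult_of_divide_less:
  fixes a b c :: ennreal
  assumes "a / b < c"
  shows "a \<le> c * b"
proof (cases "b = 0 \<or> b = top")
  case True
  then show ?thesis
  proof
    \<comment> \<open>A nonzero \<open>a\<close> divided by 0 is \<open>top\<close>, which the
      strict inequality excludes. In the other case \<open>c\<close> is positive, so
      \<open>c * top = top\<close>.\<close>
    assume b: "b = 0"
    then have "a = 0"
      using assms by (cases "a = 0") auto
    then show ?thesis by simp
  next
    assume "b = top"
    then show ?thesis using assms by (auto simp: ennreal_mult_top)
  qed
next
  case False
  then have "a = a / b * b"
    by (simp add: ennreal_divide_times less_top[symmetric] ennreal_times_divide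
        mult.commute mult_divide_eq_ennreal)
  also have "\<dots> \<le> c * b"
    using assms by (intro mult_right_mono) auto
  finally show ?thesis .
qed

lemma frequently_less_of_Liminf_less:
  fixes f :: "'a \<Rightarrow> 'b::{complete_linorder, linorder_topology}"
  assumes "Liminf F f < c"
  shows "\<exists>\<^sub>F x in F. f x < c"
proof (rule ccontr)
  assume "\<not> ?thesis"
  then have "\<forall>\<^sub>F x in F. c \<le> f x"
    by (simp add: not_frequently not_less)
  then have "c \<le> Liminf F f"
    by (rule Liminf_bounded)
  with assms show False by simp
qed

lemma frequently_at_right_0:
  fixes P :: "real \<Rightarrow> bool"
  assumes "\<exists>\<^sub>F r in at_right 0. P r" "0 < \<delta>"
  obtains r where "0 < r" "r < \<delta>" "P r"
proof -
  have "\<forall>\<^sub>F r in at_right 0. 0 < r \<and> r < \<delta>"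
    using assms(2) by (auto simp: eventually_at_right_field)
  with assms(1) have "\<exists>\<^sub>F r in at_right 0. P r \<and> 0 < r \<and> r < \<delta>"
    by (rule frequently_rev_mp[OF _ eventually_mono]) auto
  then show ?thesis
    using that by (auto dest!: frequently_ex)
qed

lemma frequently_at_right_0_sequence:
  fixes P :: "real \<Rightarrow> bool"
  assumes "\<exists>\<^sub>F r in at_right 0. P r"
  obtains r :: "nat \<Rightarrow> real" where "\<And>n. 0 < r n" "\<And>m n. m < n \<Longrightarrow> r n < r m"
    "r \<longlonglongrightarrow> 0" "\<And>n. P (r n)"
proof -
  have ex: "\<exists>r. 0 < r \<and> r < \<delta> \<and> P r" if "0 < \<delta>" for \<delta>
    using frequently_at_right_0[OF assms that] by metis
  \<comment> \<open>The bound 1/(n+1) in the invariant forces convergence to 0, which strict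
    decrease alone would not give.\<close>
  have "\<exists>r. \<forall>n::nat. (0 < r n \<and> r n < inverse (real (Suc n)) \<and> P (r n)) \<and> r (Suc n) < r n"
  proof (rule dependent_nat_choice)
    show "\<exists>r. 0 < r \<and> r < inverse (real (Suc 0)) \<and> P r"
      by (rule ex) simp
    show "\<exists>y. (0 < y \<and> y < inverse (real (Suc (Suc n))) \<and> P y) \<and> y < x"
      if "0 < x \<and> x < inverse (real (Suc n)) \<and> P x" for x n
      using ex[of "min x (inverse (real (Suc (Suc n))))"] that by auto
  qed
  then obtain r where r: "\<And>n::nat. 0 < r n" "\<And>n. r n < inverse (real (Suc n))"
    "\<And>n. P (r n)" "\<And>n. r (Suc n) < r n"
    by blast
  show ?thesis
  proof
    show "r n < r m" if "m < n" for m n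
      using lift_Suc_mono_less[of "\<lambda>n. - r n"] r(4) that by simp
    show "r \<longlonglongrightarrow> 0"
      by (rule tendsto_sandwich[OF _ _ tendsto_const LIMSEQ_inverse_real_of_nat])
        (auto intro!: always_eventually less_imp_le r simp del: of_nat_Suc)
  qed (use r in auto)
qed

section \<open>Covering estimate and the null set of zero density\<close>

text \<open>The centres need not form a Borel set, hence the outer measure. As \<open>V\<close> can
  be kept fixed while the radii vary with \<open>e\<close>, letting \<open>e\<close> tend to 0
  proves nullity when \<open>V\<close> has finite \<nu>-measure.\<close>

lemma controlled_cover_emeasure_le:
  fixes \<mu> \<nu> :: "'a::metric_space measure"
  assumes sep: "separable_space (euclidean :: 'a topology)"
    and lim: "directionally_limited_at \<xi> \<eta> \<zeta> (UNIV :: 'a set)" "\<eta> \<le> 1/2"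
    and sets: "sets \<mu> = sets borel" "sets \<nu> = sets borel"
    and s: "\<And>a. a \<in> A \<Longrightarrow> 0 < s a" "\<And>a. a \<in> A \<Longrightarrow> s a \<le> R" "R < \<xi>"
    and le: "\<And>a. a \<in> A \<Longrightarrow> emeasure \<mu> (cball a (s a)) \<le> e * emeasure \<nu> (cball a (s a))"
    and V: "V \<in> sets borel" "\<And>a. a \<in> A \<Longrightarrow> cball a (s a) \<subseteq> V"
  shows "outer_measure_of \<mu> A \<le> e * (of_nat (Suc \<zeta>) * emeasure \<nu> V)"
proof -
  obtain S where S: "S \<subseteq> A" "controlled (9/8) s S" "A \<subseteq> (\<Union>c\<in>S. cball c (s c))"
    using exists_controlled_cover[of "9/8" A s R] s by auto
  have overlap: "finite {c\<in>S. x \<in> cball c (s c)} \<and> card {c\<in>S. x \<in> cball c (s c)} \<le> Suc \<zeta>" for x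
    using S s by (intro controlled_overlap[OF lim]) force+
  have "countable S"
    using S(1) s(1) overlap by (intro countable_of_finite_overlap[OF sep, of S s]) auto
  have U: "(\<Union>c\<in>S. cball c (s c)) \<in> sets \<mu>"
    using \<open>countable S\<close> sets by (intro sets.countable_UN') auto
  have "outer_measure_of \<mu> A \<le> outer_measure_of \<mu> (\<Union>c\<in>S. cball c (s c))"
    by (rule outer_measure_of_mono[OF S(3)])
  also have "\<dots> = emeasure \<mu> (\<Union>c\<in>S. cball c (s c))"
    using U by simp
  also have "\<dots> \<le> (\<integral>\<^sup>+c. emeasure \<mu> (cball c (s c)) \<partial>count_space S)"
    using \<open>countable S\<close> sets by (intro emeasure_UN_le_nn_integral_count_space) auto
  also have "\<dots> \<le> (\<integral>\<^sup>+c. e * emeasure \<nu> (cball c (s c)) \<partial>count_space S)"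
    using le S(1) by (intro nn_integral_mono) auto
  also have "\<dots> = e * (\<integral>\<^sup>+c. emeasure \<nu> (cball c (s c)) \<partial>count_space S)"
    by (rule nn_integral_cmult) simp
  also have "\<dots> \<le> e * (of_nat (Suc \<zeta>) * emeasure \<nu> V)"
  proof (rule mult_left_mono)
    show "(\<integral>\<^sup>+c. emeasure \<nu> (cball c (s c)) \<partial>count_space S) \<le> of_nat (Suc \<zeta>) * emeasure \<nu> V"
      by (rule nn_integral_count_space_emeasure_overlap[OF \<open>countable S\<close> _ _ _ overlap])
        (use sets V S(1) in auto)
  qed simp
  finally show ?thesis .
qed

text \<open>Outer measure is attained by a measurable superset. This links the covering bound to
  null sets, which behave well under countable unions and \<open>AE\<close>.\<close>

lemma outer_measure_of_eq_0_iff: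
  "outer_measure_of M A = 0 \<and> A \<subseteq> space M \<longleftrightarrow> (\<exists>N\<in>null_sets M. A \<subseteq> N)"
proof safe
  assume "outer_measure_of M A = 0" "A \<subseteq> space M"
  then show "\<exists>N\<in>null_sets M. A \<subseteq> N"
    using outer_measure_of_attain[of A M] by (auto simp: null_sets_def)
next
  fix N assume N: "N \<in> null_sets M" "A \<subseteq> N"
  then show "outer_measure_of M A = 0"
    using outer_measure_of_mono[OF N(2), of M] by (auto simp: null_sets_def)
  show "x \<in> space M" if "x \<in> A" for x
    using N that sets.sets_into_space by (auto simp: null_sets_def)
qed

lemma lower_density_0_null:
  fixes \<mu> \<nu> :: "'a::metric_space measure"
  assumes sep: "separable_space (euclidean :: 'a topology)"
    and lim: "directionally_limited TYPE('a)"
    and bdd: "asymptotically_bounded \<alpha> \<gamma> \<nu>"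
    and sets_\<mu>: "sets \<mu> = sets borel"
  shows "\<exists>N\<in>null_sets \<mu>. {x. lower_density \<mu> \<nu> x = 0} \<subseteq> N"
proof -
  obtain \<xi> \<eta> \<zeta> where \<xi>: "0 < \<xi>" "\<eta> \<le> 1/3"
    and lim': "directionally_limited_at \<xi> \<eta> \<zeta> (UNIV :: 'a set)"
    using lim unfolding directionally_limited_def by blast
  have \<nu>: "sets \<nu> = sets borel"
    and fin: "\<And>B. B \<in> sets borel \<Longrightarrow> bounded B \<Longrightarrow> emeasure \<nu> B < \<infinity>"
    using bdd unfolding asymptotically_bounded_def by auto
  have space: "space \<mu> = UNIV"
    using sets_eq_imp_space_eq[OF sets_\<mu>] by simp
  obtain x0 :: 'a where True by blast
  \<comment> \<open>Bounded pieces are needed because \<nu> is finite only on bounded sets;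
    \<open>x0\<close> is an arbitrary base point.\<close>
  define A where "A n = {x. lower_density \<mu> \<nu> x = 0} \<inter> ball x0 (real n)" for n
  have bound: "outer_measure_of \<mu> (A n) \<le>
      ennreal e * (of_nat (Suc \<zeta>) * emeasure \<nu> (ball x0 (real n + \<xi>)))" if "0 < e" for n e
  proof -
    \<comment> \<open>Radii below \<xi>/2 stay under the scale \<xi> of the overlap bound and keep
      the balls inside one ball of radius n + \<xi>.\<close>
    have "\<exists>r. 0 < r \<and> r < \<xi> / 2 \<and>
        emeasure \<mu> (cball a r) \<le> ennreal e * emeasure \<nu> (cball a r)" if "a \<in> A n" for a
    proof -
      have "Liminf (at_right 0) (\<lambda>r. emeasure \<mu> (cball a r) / emeasure \<nu> (cball a r)) < ennreal e"
        using that \<open>0 < e\<close> by (simp add: A_def lower_density_def)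
      from frequently_at_right_0[OF frequently_less_of_Liminf_less[OF this], of "\<xi> / 2"]
      show ?thesis
        using \<xi>(1) ennreal_le_mult_of_divide_less by (metis half_gt_zero)
    qed
    then obtain s where s: "\<And>a. a \<in> A n \<Longrightarrow> 0 < s a" "\<And>a. a \<in> A n \<Longrightarrow> s a < \<xi> / 2"
      "\<And>a. a \<in> A n \<Longrightarrow> emeasure \<mu> (cball a (s a)) \<le> ennreal e * emeasure \<nu> (cball a (s a))"
      by metis
    have sub: "cball a (s a) \<subseteq> ball x0 (real n + \<xi>)" if "a \<in> A n" for a
    proof
      fix y assume "y \<in> cball a (s a)"
      moreover have "dist x0 a < real n" using that by (simp add: A_def)
      ultimately show "y \<in> ball x0 (real n + \<xi>)"
        using dist_triangle[of x0 y a] s(2)[OF that] \<xi>(1) by simp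
    qed
    show ?thesis
      using s sub \<xi> sets_\<mu> \<nu>
      by (intro controlled_cover_emeasure_le[OF sep lim', of _ _ _ s "\<xi> / 2"]) (auto intro: less_imp_le)
  qed
  have null: "outer_measure_of \<mu> (A n) = 0" for n
  proof (rule ccontr)
    assume nz: "outer_measure_of \<mu> (A n) \<noteq> 0"
    define K where "K = of_nat (Suc \<zeta>) * emeasure \<nu> (ball x0 (real n + \<xi>))"
    have "K < \<infinity>"
      using fin[of "ball x0 (real n + \<xi>)"] by (simp add: K_def ennreal_mult_less_top of_nat_less_top)
    then obtain k where k: "K = ennreal k" "0 \<le> k"
      by (cases K) auto
    have fin_o: "outer_measure_of \<mu> (A n) \<le> ennreal (e * k)" if "0 < e" for e
      using bound[OF that, of n] k that unfolding K_def[symmetric] by (simp add: ennreal_mult)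
    obtain m where m: "outer_measure_of \<mu> (A n) = ennreal m" "0 \<le> m"
      using fin_o[of 1] by (cases "outer_measure_of \<mu> (A n)") (auto simp: top_unique)
    then have "0 < m" using nz by (cases "m = 0") auto
    \<comment> \<open>This choice of \<open>e\<close> makes the bound less than m/2; adding 1 to
      \<open>k\<close> avoids division by zero.\<close>
    have "m \<le> m / (2 * (k + 1)) * k"
      using fin_o[of "m / (2 * (k + 1))"] \<open>0 < m\<close> k m by simp
    then have "m * (k + 2) \<le> 0"
      using k(2) by (simp add: field_simps)
    then show False
      using \<open>0 < m\<close> k(2) mult_pos_pos[of m "k + 2"] by linarith
  qed
  have "\<exists>N\<in>null_sets \<mu>. A n \<subseteq> N" for n
    using null[of n] outer_measure_of_eq_0_iff[of \<mu> "A n"] space by simp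
  then obtain N where N: "\<And>n. N n \<in> null_sets \<mu>" "\<And>n. A n \<subseteq> N n"
    by metis
  have "{x. lower_density \<mu> \<nu> x = 0} \<subseteq> (\<Union>n. N n)"
  proof
    fix x assume x: "x \<in> {x. lower_density \<mu> \<nu> x = 0}"
    obtain n where "dist x0 x < real n" using reals_Archimedean2 by blast
    then have "x \<in> A n" using x by (simp add: A_def)
    then show "x \<in> (\<Union>n. N n)" using N(2) by blast
  qed
  then show ?thesis
    using null_sets_UN[of N \<mu>] N(1) by blast
qed

section \<open>Decay of the density along radii shrinking by \<alpha>\<close>

lemma Liminf_ratio_le:
  fixes \<mu> \<nu> :: "'a::metric_space measure"
  assumes \<alpha>: "0 < \<alpha>" "\<alpha> \<le> 1" and \<gamma>: "1 \<le> \<gamma>"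
    and bdd: "asymptotically_bounded \<alpha> \<gamma> \<nu>"
    and sets_\<mu>: "sets \<mu> = sets borel"
    and pos: "0 < lower_density \<mu> \<nu> x"
    and r0: "0 < r0" "emeasure \<mu> (cball x r0) < \<infinity>"
  shows "Liminf (at_right 0) (\<lambda>r. emeasure \<mu> (cball x r) / emeasure \<mu> (cball x (\<alpha> * r)))
    \<le> ennreal \<gamma>"
proof (rule ccontr)
  let ?L = "Liminf (at_right 0) (\<lambda>r. emeasure \<mu> (cball x r) / emeasure \<mu> (cball x (\<alpha> * r)))"
  assume "\<not> ?L \<le> ennreal \<gamma>"
  \<comment> \<open>The lower limit may be \<open>top\<close>. Two intermediate values separate the
    \<mu>-ratio (above q) from the \<nu>-ratio (below p), and both are finite because something lies
    strictly above them.\<close>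
  then obtain q' where q': "ennreal \<gamma> < q'" "q' < ?L"
    using dense[of "ennreal \<gamma>" ?L] by (auto simp: not_le)
  then obtain p' where p': "ennreal \<gamma> < p'" "p' < q'"
    using dense[of "ennreal \<gamma>" q'] by auto
  obtain q where q: "q' = ennreal q" "0 \<le> q"
    using q' by (cases q') auto
  obtain p where p: "p' = ennreal p" "0 \<le> p"
    using p' by (cases p') auto
  have pq: "1 \<le> p" "p < q"
    using p' p q \<gamma> by (auto simp: ennreal_less_iff)
  obtain l' where l': "0 < l'" "l' < lower_density \<mu> \<nu> x"
    using dense[OF pos] by blast
  obtain l where l: "l' = ennreal l" "0 < l"
    using l' by (cases l') auto
  define m where "m r = measure \<mu> (cball x r)" for r
  define v where "v r = measure \<nu> (cball x r)" for r
  have fin_\<nu>: "emeasure \<nu> (cball x r) = ennreal (v r)" and pos_\<nu>: "0 < v r" if "0 < r" for r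
  proof -
    have *: "emeasure \<nu> (cball x r) < \<infinity>" "0 < emeasure \<nu> (cball x r)"
      using bdd that unfolding asymptotically_bounded_def by auto
    then show "emeasure \<nu> (cball x r) = ennreal (v r)"
      by (simp add: v_def emeasure_eq_ennreal_measure)
    with * show "0 < v r" by simp
  qed
  have fin_\<mu>: "emeasure \<mu> (cball x r) = ennreal (m r)" if "r \<le> r0" for r
  proof -
    have "emeasure \<mu> (cball x r) \<le> emeasure \<mu> (cball x r0)"
      using that sets_\<mu> by (intro emeasure_mono) auto
    then have "emeasure \<mu> (cball x r) < \<infinity>"
      using r0(2) by simp
    then show ?thesis by (simp add: m_def emeasure_eq_ennreal_measure)
  qed
  have "\<forall>\<^sub>F r in at_right 0. ennreal q < emeasure \<mu> (cball x r) / emeasure \<mu> (cball x (\<alpha> * r))"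
    using q'(2) q(1) by (auto dest: less_LiminfD)
  moreover have "\<forall>\<^sub>F r in at_right 0.
      emeasure \<nu> (cball x r) / emeasure \<nu> (cball x (\<alpha> * r)) < ennreal p"
  proof -
    have "Limsup (at_right 0) (\<lambda>r. emeasure \<nu> (cball x r) / emeasure \<nu> (cball x (\<alpha> * r))) < ennreal p"
      using bdd p'(1) unfolding asymptotically_bounded_def p(1)
      by (blast intro: le_less_trans)
    then show ?thesis by (auto dest: Limsup_lessD)
  qed
  moreover have "\<forall>\<^sub>F r in at_right 0. ennreal l < emeasure \<mu> (cball x r) / emeasure \<nu> (cball x r)"
    using l'(2) l(1) unfolding lower_density_def by (auto dest: less_LiminfD)
  ultimately have "\<forall>\<^sub>F r in at_right 0.
      ennreal q < emeasure \<mu> (cball x r) / emeasure \<mu> (cball x (\<alpha> * r)) \<and>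
      emeasure \<nu> (cball x r) / emeasure \<nu> (cball x (\<alpha> * r)) < ennreal p \<and>
      ennreal l < emeasure \<mu> (cball x r) / emeasure \<nu> (cball x r)"
    by eventually_elim auto
  then obtain r1 where r1: "0 < r1" and near:
    "\<And>r. 0 < r \<Longrightarrow> r < r1 \<Longrightarrow> ennreal q < emeasure \<mu> (cball x r) / emeasure \<mu> (cball x (\<alpha> * r))"
    "\<And>r. 0 < r \<Longrightarrow> r < r1 \<Longrightarrow> emeasure \<nu> (cball x r) / emeasure \<nu> (cball x (\<alpha> * r)) < ennreal p"
    "\<And>r. 0 < r \<Longrightarrow> r < r1 \<Longrightarrow> ennreal l < emeasure \<mu> (cball x r) / emeasure \<nu> (cball x r)"
    unfolding eventually_at_right_field by auto
  define \<rho> where "\<rho> = min r0 (r1 / 2)"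
  have \<rho>: "0 < \<rho>" "\<rho> \<le> r0" "\<rho> < r1"
    using r0 r1 by (auto simp: \<rho>_def)
  \<comment> \<open>Besides contradicting the decay at the end, this makes \<open>m\<close>
    positive, so the extended quotients become real ones.\<close>
  have lower: "l * v r < m r" if "0 < r" "r \<le> \<rho>" for r
  proof -
    have "ennreal l < ennreal (m r / v r)"
      using near(3)[of r] that \<rho> fin_\<mu>[of r] fin_\<nu>[of r] pos_\<nu>[of r]
      by (simp add: divide_ennreal m_def)
    then show ?thesis
      using l(2) pos_\<nu>[OF that(1)] by (simp add: ennreal_less_iff field_simps)
  qed
  have step: "m (\<alpha> * r) / v (\<alpha> * r) \<le> p / q * (m r / v r)" if r: "0 < r" "r \<le> \<rho>" for r
  proof -
    have ar: "0 < \<alpha> * r" "\<alpha> * r \<le> \<rho>"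
      using \<alpha> r mult_left_le_one_le[of r \<alpha>] by (simp, linarith)
    have mpos: "0 < m r'" if "0 < r'" "r' \<le> \<rho>" for r'
      using lower[OF that] mult_pos_pos[OF l(2) pos_\<nu>[OF that(1)]] by linarith
    have "ennreal q < ennreal (m r / m (\<alpha> * r))"
      using near(1)[of r] r ar \<rho> fin_\<mu>[of r] fin_\<mu>[of "\<alpha> * r"] mpos[OF ar]
      by (simp add: divide_ennreal m_def)
    then have A: "q * m (\<alpha> * r) \<le> m r"
      using q(2) mpos[OF ar] by (simp add: ennreal_less_iff field_simps)
    have "ennreal (v r / v (\<alpha> * r)) < ennreal p"
      using near(2)[of r] r ar \<rho> fin_\<nu>[of r] fin_\<nu>[of "\<alpha> * r"] pos_\<nu>[of "\<alpha> * r"]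
      by (simp add: divide_ennreal v_def)
    then have B: "v r \<le> p * v (\<alpha> * r)"
      using pq pos_\<nu>[OF ar(1)] pos_\<nu>[OF r(1)] by (simp add: ennreal_less_iff field_simps)
    have "(q * m (\<alpha> * r)) * v r \<le> m r * (p * v (\<alpha> * r))"
      using A B mpos[OF r] pos_\<nu>[OF r(1)] by (intro mult_mono) auto
    then show ?thesis
      using pos_\<nu>[OF r(1)] pos_\<nu>[OF ar(1)] pq by (simp add: field_simps)
  qed
  \<comment> \<open>The radii only have to stay in (0, \<rho>], so \<alpha> = 1 is covered: the
    contradiction comes from the powers of p/q.\<close>
  have radii: "0 < \<alpha> ^ n * \<rho>" "\<alpha> ^ n * \<rho> \<le> \<rho>" for n
    using \<alpha> \<rho>(1) by (auto simp: power_le_one mult_left_le_one_le)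
  have iterate: "m (\<alpha> ^ n * \<rho>) / v (\<alpha> ^ n * \<rho>) \<le> (p / q) ^ n * (m \<rho> / v \<rho>)" for n
  proof (induction n)
    case (Suc n)
    have "m (\<alpha> ^ Suc n * \<rho>) / v (\<alpha> ^ Suc n * \<rho>) \<le> p / q * (m (\<alpha> ^ n * \<rho>) / v (\<alpha> ^ n * \<rho>))"
      using step[OF radii[of n]] by (simp add: mult.assoc)
    also have "\<dots> \<le> p / q * ((p / q) ^ n * (m \<rho> / v \<rho>))"
      using Suc pq by (intro mult_left_mono) auto
    finally show ?case by (simp add: mult.assoc)
  qed simp
  have "(\<lambda>n. (p / q) ^ n * (m \<rho> / v \<rho>)) \<longlonglongrightarrow> 0 * (m \<rho> / v \<rho>)"
    using pq by (intro tendsto_mult LIMSEQ_realpow_zero tendsto_const) auto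
  then have "\<forall>\<^sub>F n in sequentially. (p / q) ^ n * (m \<rho> / v \<rho>) < l"
    using l(2) by (intro order_tendstoD) auto
  then obtain n where n: "(p / q) ^ n * (m \<rho> / v \<rho>) < l"
    by (auto simp: eventually_sequentially)
  have "l < m (\<alpha> ^ n * \<rho>) / v (\<alpha> ^ n * \<rho>)"
    using lower[OF radii[of n]] pos_\<nu>[OF radii(1)[of n]] by (simp add: field_simps)
  with iterate[of n] n show False by linarith
qed

theorem proposition3p4:
  fixes \<mu> \<nu> :: "'a::metric_space measure"
    and \<alpha> \<gamma> :: real
    and A0 Aplus :: "'a set"
  assumes "separable_space (euclidean :: 'a topology)"
    and "directionally_limited TYPE('a)"
    and "0 < \<alpha>" and "\<alpha> \<le> 1" and "1 \<le> \<gamma>"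
    and "asymptotically_bounded \<alpha> \<gamma> \<nu>"
    and "sets \<mu> = sets borel"
    and "A0 = {x. lower_density \<mu> \<nu> x = 0}"
    and "Aplus = {x. 0 < lower_density \<mu> \<nu> x \<and> lower_density \<mu> \<nu> x \<le> \<infinity>}"
  shows "(\<forall>x\<in>Aplus.
            (\<forall>r>0. emeasure \<mu> (cball x r) = \<infinity>) \<or>
            Liminf (at_right 0)
              (\<lambda>r. emeasure \<mu> (cball x r) / emeasure \<mu> (cball x (\<alpha> * r))) \<le> ennreal \<gamma>)
       \<and> outer_measure_of \<mu> A0 = 0
       \<and> (\<forall>\<epsilon>0>0. AE x in \<mu>. \<exists>r :: nat \<Rightarrow> real.
            (\<forall>n. 0 < r n) \<and> (\<forall>m n. m < n \<longrightarrow> r n < r m) \<and> r \<longlonglongrightarrow> 0 \<and>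
            (\<forall>n. emeasure \<mu> (cball x (r n))
                  \<le> ennreal (\<gamma> + \<epsilon>0) * emeasure \<mu> (cball x (\<alpha> * r n))))"
proof (intro conjI allI impI)
  show i: "\<forall>x\<in>Aplus. (\<forall>r>0. emeasure \<mu> (cball x r) = \<infinity>) \<or>
      Liminf (at_right 0)
        (\<lambda>r. emeasure \<mu> (cball x r) / emeasure \<mu> (cball x (\<alpha> * r))) \<le> ennreal \<gamma>"
    using Liminf_ratio_le[OF assms(3-7)] assms(9)
    by (metis (no_types, lifting) infinity_ennreal_def mem_Collect_eq top.not_eq_extremum)
  \<comment> \<open>One Borel null set containing \<open>A0\<close> serves both the outer measure
    claim and the almost everywhere claim.\<close>
  obtain N where N: "N \<in> null_sets \<mu>" "A0 \<subseteq> N"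
    using lower_density_0_null[OF assms(1,2,6,7)] assms(8) by blast
  then show "outer_measure_of \<mu> A0 = 0"
    using outer_measure_of_eq_0_iff by blast
  fix \<epsilon>0 :: real assume "0 < \<epsilon>0"
  let ?P = "\<lambda>x r. emeasure \<mu> (cball x r) \<le> ennreal (\<gamma> + \<epsilon>0) * emeasure \<mu> (cball x (\<alpha> * r))"
  have freq: "\<exists>\<^sub>F r in at_right 0. ?P x r" if "x \<notin> A0" for x
  proof (cases "\<forall>r>0. emeasure \<mu> (cball x r) = \<infinity>")
    case True
    \<comment> \<open>The smaller ball is infinite too, and \<gamma> + \<epsilon>0 is positive, so
      the right side is \<open>top\<close>.\<close>
    have "?P x r" if "0 < r" for r
      using True assms(3,5) \<open>0 < \<epsilon>0\<close> that by (simp add: ennreal_mult_top)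
    then have "\<forall>\<^sub>F r in at_right 0. ?P x r"
      by (rule eventually_mono[OF eventually_at_right_less])
    then show ?thesis
      by (intro eventually_frequently) auto
  next
    case False
    have "x \<in> Aplus"
      using that assms(8,9) by (auto simp: zero_less_iff_neq_zero)
    then have "Liminf (at_right 0)
        (\<lambda>r. emeasure \<mu> (cball x r) / emeasure \<mu> (cball x (\<alpha> * r))) \<le> ennreal \<gamma>"
      using i False by blast
    \<comment> \<open>The slack \<epsilon>0 makes the bound strict, which is what yields arbitrarily
      small good radii from a lower limit.\<close>
    also have "\<dots> < ennreal (\<gamma> + \<epsilon>0)"
      using assms(5) \<open>0 < \<epsilon>0\<close> by (simp add: ennreal_less_iff)
    finally have "\<exists>\<^sub>F r in at_right 0.
        emeasure \<mu> (cball x r) / emeasure \<mu> (cball x (\<alpha> * r)) < ennreal (\<gamma> + \<epsilon>0)"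
      by (rule frequently_less_of_Liminf_less)
    then show ?thesis
      by (rule frequently_elim1) (rule ennreal_le_mult_of_divide_less)
  qed
  show "AE x in \<mu>. \<exists>r :: nat \<Rightarrow> real.
      (\<forall>n. 0 < r n) \<and> (\<forall>m n. m < n \<longrightarrow> r n < r m) \<and> r \<longlonglongrightarrow> 0 \<and> (\<forall>n. ?P x (r n))"
    using AE_not_in[OF N(1)]
  proof eventually_elim
    case (elim x)
    then have "x \<notin> A0"
      using N(2) by blast
    obtain r :: "nat \<Rightarrow> real" where "\<And>n. 0 < r n" "\<And>m n. m < n \<Longrightarrow> r n < r m"
      "r \<longlonglongrightarrow> 0" "\<And>n. ?P x (r n)"
      using frequently_at_right_0_sequence[OF freq[OF \<open>x \<notin> A0\<close>]] by blast
    then show ?case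
      by (intro exI[of _ r]) auto
  qed
qed

end
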